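(* Let $\alpha\in\mathbb{R}$ and let $\vec E=\left(E_0,\frac{x_1}{\rho}E_\rho,\frac{x_2}{\rho}E_\rho\right)$ be a meridional field, where $E_0=E_0(x_0,\rho)$ and $E_\rho=E_\rho(x_0,\rho)$ are real-valued $C^1$ functions for $\rho>0$ satisfying $$\rho\left(\frac{\partial E_0}{\partial x_0}+\frac{\partial E_\rho}{\partial\rho}\right)-(\alpha-1)E_\rho=0,\qquad \frac{\partial E_0}{\partial\rho}=\frac{\partial E_\rho}{\partial x_0}.$$ Then the roots of the characteristic equation of the electric field gradient tensor $\mathbf{J}(\vec E)=\left(\frac{\partial E_l}{\partial x_m}\right)_{l,m=0,1,2}$ at each point are $$\lambda_0=\frac{E_\rho}{\rho},$$ $$\lambda_{1,2}=\frac{\alpha-1}{2}\frac{E_\rho}{\rho}\pm\sqrt{\frac{(\alpha-1)^2}{4}\left(\frac{E_\rho}{\rho}\right)^2-(\alpha-1)\frac{E_\rho}{\rho}\frac{\partial E_\rho}{\partial\rho}+\left(\frac{\partial E_\rho}{\partial x_0}\right)^2+\left(\frac{\partial E_\rho}{\partial\rho}\right)^2},$$ so that $$\lambda_1\lambda_2=(\alpha-1)\frac{E_\rho}{\rho}\frac{\partial E_\rho}{\partial\rho}-\left(\frac{\partial E_\rho}{\partial x_0}\right)^2-\left(\frac{\partial E_\rho}{\partial\rho}\right)^2.$$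
   Context: Here $\mathbb{R}^3=\{(x_0,x_1,x_2)\}$, $\rho=\sqrt{x_1^2+x_2^2}>0$, and the components of $\vec E$ are $E_0$, $E_1=\frac{x_1}{\rho}E_\rho$, $E_2=\frac{x_2}{\rho}E_\rho$. Under the stated system the tensor $\mathbf{J}(\vec E)$ equals the symmetric matrix $$\begin{pmatrix}-\frac{\partial E_\rho}{\partial\rho}+(\alpha-1)\frac{E_\rho}{\rho} & \frac{\partial E_\rho}{\partial x_0}\frac{x_1}{\rho} & \frac{\partial E_\rho}{\partial x_0}\frac{x_2}{\rho}\\ \frac{\partial E_\rho}{\partial x_0}\frac{x_1}{\rho} & \frac{\partial E_\rho}{\partial\rho}\frac{x_1^2}{\rho^2}+\frac{E_\rho}{\rho}\frac{x_2^2}{\rho^2} & \left(\frac{\partial E_\rho}{\partial\rho}-\frac{E_\rho}{\rho}\right)\frac{x_1x_2}{\rho^2}\\ \frac{\partial E_\rho}{\partial x_0}\frac{x_2}{\rho} & \left(\frac{\partial E_\rho}{\partial\rho}-\frac{E_\rho}{\rho}\right)\frac{x_1x_2}{\rho^2} & \frac{\partial E_\rho}{\partial\rho}\frac{x_2^2}{\rho^2}+\frac{E_\rho}{\rho}\frac{x_1^2}{\rho^2}\end{pmatrix}.$$ The characteristic equation is $\det(\lambda\,\mathrm{Id}-\mathbf{J}(\vec E))=0$, and its three roots are listed with multiplicity. *)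

theory Defs
  imports "HOL-Analysis.Analysis" "HOL-Computational_Algebra.Polynomial"
begin

text \<open>
  Points of $\mathbb{R}^3$ are written $(x_0,x_1,x_2)$ by using the elements \<open>0, 1, 2\<close> of the
  index type \<open>3\<close>. In this type \<open>3 = 0\<close>, so \<open>x $ 0\<close> is the component that
  library lemmas such as \<open>sum_3\<close> and \<open>det_3\<close> write as \<open>x $ 3\<close>.
\<close>

definition rho :: "real^3 \<Rightarrow> real" where
  "rho x = sqrt ((x $ 1)\<^sup>2 + (x $ 2)\<^sup>2)"

text \<open>
  The components \<open>E0\<close> and \<open>Er\<close> are functions of the pair $(x_0,\rho)$. On the axis
  \<open>rho x = 0\<close> the value below is an artefact of division by zero.
\<close>

definition meridional_field ::
    "(real \<Rightarrow> real \<Rightarrow> real) \<Rightarrow> (real \<Rightarrow> real \<Rightarrow> real) \<Rightarrow> real^3 \<Rightarrow> real^3" where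
  "meridional_field E0 Er x =
     (\<chi> i. if i = 0 then E0 (x $ 0) (rho x) else x $ i / rho x * Er (x $ 0) (rho x))"

definition d_x0 :: "(real \<Rightarrow> real \<Rightarrow> real) \<Rightarrow> real \<Rightarrow> real \<Rightarrow> real" where
  "d_x0 f x0 r = deriv (\<lambda>t. f t r) x0"

definition d_rho :: "(real \<Rightarrow> real \<Rightarrow> real) \<Rightarrow> real \<Rightarrow> real \<Rightarrow> real" where
  "d_rho f x0 r = deriv (\<lambda>t. f x0 t) r"

text \<open>Intended for open \<open>S\<close>: the derivative is taken with respect to the full space.\<close>

definition C1_on :: "'a::real_normed_vector set \<Rightarrow> ('a \<Rightarrow> 'b::real_normed_vector) \<Rightarrow> bool" where
  "C1_on S f \<longleftrightarrow>
     (\<exists>f' :: 'a \<Rightarrow> 'a \<Rightarrow>\<^sub>L 'b.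
        (\<forall>x\<in>S. (f has_derivative blinfun_apply (f' x)) (at x)) \<and> continuous_on S f')"

text \<open>The gradient tensor of a vector field has entry $\partial F_l/\partial x_m$ in row \<open>l\<close>,
  column \<open>m\<close>; see \<open>gradient_tensor_nth\<close>.\<close>

definition gradient_tensor :: "(real^3 \<Rightarrow> real^3) \<Rightarrow> real^3 \<Rightarrow> real^3^3" where
  "gradient_tensor F x = jacobian F (at x)"

lemma gradient_tensor_nth:
  assumes "F differentiable (at x)"
  shows "gradient_tensor F x $ l $ m = deriv (\<lambda>t. F (x + t *\<^sub>R axis m 1) $ l) 0"
proof -
  have "(F has_derivative (\<lambda>h. gradient_tensor F x *v h)) (at x)"
    using assms unfolding gradient_tensor_def jacobian_works .
  then have D: "(F has_derivative (\<lambda>h. gradient_tensor F x *v h)) (at (x + 0 *\<^sub>R axis m 1))"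
    by simp
  have "((\<lambda>t. x + t *\<^sub>R axis m 1) has_derivative (\<lambda>t. t *\<^sub>R axis m 1)) (at 0)"
    by (auto intro!: derivative_eq_intros)
  from has_derivative_compose[OF this D]
  have "((\<lambda>t. F (x + t *\<^sub>R axis m 1)) has_derivative
          (\<lambda>t. gradient_tensor F x *v (t *\<^sub>R axis m 1))) (at 0)" .
  then have "((\<lambda>t. F (x + t *\<^sub>R axis m 1) $ l) has_derivative
          (\<lambda>t. (gradient_tensor F x *v (t *\<^sub>R axis m 1)) $ l)) (at 0)"
    by (rule bounded_linear.has_derivative[OF bounded_linear_vec_nth])
  moreover have "(gradient_tensor F x *v (t *\<^sub>R axis m 1)) $ l = gradient_tensor F x $ l $ m * t" for t
    by (simp add: matrix_vector_mult_scaleR matrix_vector_mul_component inner_axis)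
  ultimately have "((\<lambda>t. F (x + t *\<^sub>R axis m 1) $ l) has_field_derivative
      gradient_tensor F x $ l $ m) (at 0)"
    by (simp add: has_field_derivative_def)
  then show ?thesis by (simp add: DERIV_imp_deriv)
qed

definition charpoly :: "real^'n^'n \<Rightarrow> real poly" where
  "charpoly A = det (\<chi> i j. (if i = j then [:0, 1:] else 0) - [:A $ i $ j:])"

lemma poly_charpoly: "poly (charpoly A) l = det (l *\<^sub>R mat 1 - A)"
proof -
  have "poly (charpoly A) l =
      (\<Sum>p | p permutes UNIV. of_int (sign p) *
        (\<Prod>i\<in>UNIV. poly ((if i = p i then [:0, 1:] else 0) - [:A $ i $ p i:]) l))"
    by (simp add: charpoly_def det_def poly_sum poly_prod)
  also have "\<dots> = det (l *\<^sub>R mat 1 - A)"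
    unfolding det_def by (intro sum.cong refl arg_cong2[of _ _ _ _ "(*)"] prod.cong)
      (auto simp: mat_def)
  finally show ?thesis .
qed

end

theory Submission
  imports Defs
begin

text \<open>
  With $c = (x_1, x_2)/\rho$ the tensor is rotationally equivariant in the last two coordinates:
  the direction orthogonal to $c$ is an eigenvector for $E_\rho/\rho$, and on the complement the
  tensor acts as the symmetric block with diagonal $\partial E_0/\partial x_0$,
  $\partial E_\rho/\partial\rho$. The divergence equation determines the trace of this block, and
  its discriminant is a sum of two squares, so its roots are real.
\<close>

text \<open>\<open>d_x0\<close> and \<open>d_rho\<close> are defined by \<open>deriv\<close> along
  lines; this ties them to the total derivative, which the chain rule needs.\<close>

lemma C1_on_has_derivative_partials:
  assumes "C1_on {(x0, r). r > 0} (\<lambda>(x0, r). f x0 r)" and "r > 0"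
  shows "((\<lambda>(x0, r). f x0 r) has_derivative (\<lambda>(h, k). d_x0 f x0 r * h + d_rho f x0 r * k))
           (at (x0, r))"
proof -
  obtain L where L: "((\<lambda>(x0, r). f x0 r) has_derivative L) (at (x0, r))"
    using assms unfolding C1_on_def by blast
  then interpret L: bounded_linear L by (rule has_derivative_bounded_linear)
  have "((\<lambda>t. (t, r)) has_derivative (\<lambda>h. (h, 0))) (at x0)"
    and "((\<lambda>t. (x0, t)) has_derivative (\<lambda>k. (0, k))) (at r)"
    by (auto intro!: derivative_eq_intros)
  \<comment> \<open>Restricting to the two coordinate lines through the point identifies
    \<open>L (1, 0)\<close> and \<open>L (0, 1)\<close> with the partial derivatives; linearity then
    recovers all of \<open>L\<close>.\<close>
  from this[THEN has_derivative_compose, OF L]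
  have "((\<lambda>t. f t r) has_derivative (\<lambda>h. L (h, 0))) (at x0)"
    and "((\<lambda>t. f x0 t) has_derivative (\<lambda>k. L (0, k))) (at r)"
    by simp_all
  moreover have "L (h, 0) = L (1, 0) * h" for h
    using L.scaleR[of h "(1, 0)"] by simp
  then have fst_lin: "(\<lambda>h. L (h, 0)) = (*) (L (1, 0))" by (rule ext)
  moreover have "L (0, k) = L (0, 1) * k" for k
    using L.scaleR[of k "(0, 1)"] by simp
  then have snd_lin: "(\<lambda>k. L (0, k)) = (*) (L (0, 1))" by (rule ext)
  ultimately have "((\<lambda>t. f t r) has_field_derivative L (1, 0)) (at x0)"
    and "((\<lambda>t. f x0 t) has_field_derivative L (0, 1)) (at r)"
    unfolding has_field_derivative_def by simp_all
  then have partials: "d_x0 f x0 r = L (1, 0)" "d_rho f x0 r = L (0, 1)"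
    by (simp_all add: d_x0_def d_rho_def DERIV_imp_deriv)
  have "L (h, k) = d_x0 f x0 r * h + d_rho f x0 r * k" for h k
    using L.add[of "(h, 0)" "(0, k)"] fun_cong[OF fst_lin, of h] fun_cong[OF snd_lin, of k] by (simp add: partials)
  then have "L = (\<lambda>(h, k). d_x0 f x0 r * h + d_rho f x0 r * k)"
    by auto
  with L show ?thesis by simp
qed

text \<open>Off the axis the radicand is positive, so \<open>sqrt\<close> is differentiable there
  and the chain rule applies.\<close>

lemma has_derivative_rho:
  assumes "rho x > 0"
  shows "(rho has_derivative (\<lambda>h. (x $ 1 * h $ 1 + x $ 2 * h $ 2) / rho x)) (at x)"
proof -
  have pos: "(x $ 1)\<^sup>2 + (x $ 2)\<^sup>2 > 0"
    using assms by (simp add: rho_def)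
  have "((\<lambda>y. (y $ 1)\<^sup>2 + (y $ 2)\<^sup>2) has_derivative
      (\<lambda>h. 2 * (x $ 1 * h $ 1 + x $ 2 * h $ 2))) (at x)"
    by (auto intro!: derivative_eq_intros bounded_linear.has_derivative[OF bounded_linear_vec_nth]
        simp: algebra_simps)
  then have "(rho has_derivative
      (\<lambda>h. 2 * (x $ 1 * h $ 1 + x $ 2 * h $ 2) * (inverse (rho x) / 2))) (at x)"
    unfolding rho_def[abs_def]
    by (rule DERIV_compose_FDERIV[where f = sqrt, rotated]) (rule DERIV_real_sqrt[OF pos])
  moreover have "2 * u * (inverse (rho x) / 2) = u / rho x" for u
    unfolding divide_inverse by simp
  ultimately show ?thesis by (simp only:)
qed

lemma has_derivative_meridional:
  assumes "C1_on {(x0, r). r > 0} (\<lambda>(x0, r). f x0 r)" and "rho x > 0"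
  shows "((\<lambda>y. f (y $ 0) (rho y)) has_derivative
           (\<lambda>h. d_x0 f (x $ 0) (rho x) * h $ 0
              + d_rho f (x $ 0) (rho x) * ((x $ 1 * h $ 1 + x $ 2 * h $ 2) / rho x))) (at x)"
proof -
  have "((\<lambda>y. (y $ 0, rho y)) has_derivative
      (\<lambda>h. (h $ 0, (x $ 1 * h $ 1 + x $ 2 * h $ 2) / rho x))) (at x)"
    by (intro has_derivative_Pair has_derivative_rho assms
        bounded_linear.has_derivative[OF bounded_linear_vec_nth] has_derivative_ident)
  from has_derivative_compose[OF this C1_on_has_derivative_partials[OF assms]]
  show ?thesis by simp
qed

text \<open>Componentwise derivatives assemble into a total derivative; its uniqueness lets the
  matrix be read off from the linear map.\<close>

lemma gradient_tensor_eqI: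
  assumes "\<And>l. ((\<lambda>y. F y $ l) has_derivative (\<lambda>h. (J *v h) $ l)) (at x)"
  shows "gradient_tensor F x = J"
proof -
  have "(F has_derivative (\<lambda>h. J *v h)) (at x)"
    using assms by (subst has_derivative_componentwise_within)
      (auto simp: Basis_vec_def inner_axis)
  then show ?thesis
    unfolding gradient_tensor_def jacobian_def
    by (metis frechet_derivative_at matrix_of_matrix_vector_mul)
qed

text \<open>Lets the simplifier decide the test \<open>i = 0\<close> in the terms that
  \<open>sum_3\<close> indexes by \<open>3\<close>.\<close>

lemma numeral_3_eq_0: "(3 :: 3) = 0"
  by simp

text \<open>For l = 1, 2 the component is x_l q, where q as a function of (x_0, rho) has
  rho-derivative (b - q) / rho; the product rule gives the lower block. The curl equation is not yet
  applied, so \<open>er\<close> and \<open>a\<close> stay distinct.\<close>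

lemma gradient_tensor_meridional_field:
  fixes E0 Er :: "real \<Rightarrow> real \<Rightarrow> real" and x :: "real^3"
  assumes "C1_on {(x0, r). r > 0} (\<lambda>(x0, r). E0 x0 r)"
    and "C1_on {(x0, r). r > 0} (\<lambda>(x0, r). Er x0 r)"
    and "rho x > 0"
  defines "c \<equiv> \<lambda>i. x $ i / rho x"
    and "q \<equiv> Er (x $ 0) (rho x) / rho x"
    and "e0 \<equiv> d_x0 E0 (x $ 0) (rho x)" and "er \<equiv> d_rho E0 (x $ 0) (rho x)"
    and "a \<equiv> d_x0 Er (x $ 0) (rho x)" and "b \<equiv> d_rho Er (x $ 0) (rho x)"
  shows "gradient_tensor (meridional_field E0 Er) x =
    (\<chi> l m. if l = 0 then (if m = 0 then e0 else er * c m)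
            else if m = 0 then a * c l
            else (b - q) * c l * c m + (if l = m then q else 0))"
proof (rule gradient_tensor_eqI)
  fix l :: 3
  note D = has_derivative_meridional[OF assms(1,3)] has_derivative_meridional[OF assms(2,3)]
    has_derivative_rho[OF assms(3)] bounded_linear.has_derivative[OF bounded_linear_vec_nth]
  consider "l = 0" | "l = 1" | "l = 2" using exhaust_3[of l] by auto
  then show "((\<lambda>y. meridional_field E0 Er y $ l) has_derivative
    (\<lambda>h. ((\<chi> l m. if l = 0 then (if m = 0 then e0 else er * c m)
            else if m = 0 then a * c l
            else (b - q) * c l * c m + (if l = m then q else 0)) *v h) $ l)) (at x)"
  proof cases
    case 1
    then show ?thesis
      using D(1)
      by (simp add: meridional_field_def matrix_vector_mult_def sum_3 numeral_3_eq_0 c_def e0_def er_def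
          algebra_simps add_divide_distrib)
  next
    case 2
    \<comment> \<open>Once the product and quotient rules are applied, both sides agree as rational
      expressions in which \<open>rho x\<close> is just a nonzero quantity.\<close>
    show ?thesis
      unfolding 2 meridional_field_def
      using assms(3)
      by (auto intro!: derivative_eq_intros D simp: matrix_vector_mult_def sum_3 numeral_3_eq_0 fun_eq_iff
          c_def a_def b_def q_def)
        (simp add: field_simps power2_eq_square)
  next
    case 3
    show ?thesis
      unfolding 3 meridional_field_def
      using assms(3)
      by (auto intro!: derivative_eq_intros D simp: matrix_vector_mult_def sum_3 numeral_3_eq_0 fun_eq_iff
          c_def a_def b_def q_def)
        (simp add: field_simps power2_eq_square)
  qed
qed

text \<open>The determinant depends on \<open>c\<close> only through its squared length. The
  quadratic factor is the characteristic polynomial of the symmetric 2 by 2 block with diagonal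
  \<open>p\<close>, \<open>b\<close> and off-diagonal entry \<open>a\<close>.\<close>

lemma charpoly_meridional:
  fixes c :: "3 \<Rightarrow> real" and p q a b :: real
  assumes "(c 1)\<^sup>2 + (c 2)\<^sup>2 = 1"
  shows "charpoly (\<chi> l m. if l = 0 then (if m = 0 then p else a * c m)
            else if m = 0 then a * c l
            else (b - q) * c l * c m + (if l = m then q else 0))
    = [:- q, 1:] * [:p * b - a\<^sup>2, - (p + b), 1:]" (is "charpoly ?J = ?P")
proof -
  have "poly (charpoly ?J) t = poly ?P t" for t
  proof -
    \<comment> \<open>This form holds for every \<open>c\<close>; it isolates the squared length, so
      that the assumption can be substituted.\<close>
    have "poly (charpoly ?J) t =
        (t - q) * ((t - p) * (t - q - (b - q) * ((c 1)\<^sup>2 + (c 2)\<^sup>2))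
                   - a\<^sup>2 * ((c 1)\<^sup>2 + (c 2)\<^sup>2))"
      by (simp add: poly_charpoly det_3 mat_def) (simp add: algebra_simps power2_eq_square)
    also have "\<dots> = poly ?P t"
      unfolding assms by (simp add: algebra_simps power2_eq_square)
    finally show ?thesis .
  qed
  then have "poly (charpoly ?J) = poly ?P" by (rule ext)
  then show ?thesis unfolding poly_eq_poly_eq_iff .
qed

theorem theorem5p3:
  fixes \<alpha> :: real
    and E0 Er :: "real \<Rightarrow> real \<Rightarrow> real"
    and x :: "real^3"
  assumes C1_E0: "C1_on {(x0, r). r > 0} (\<lambda>(x0, r). E0 x0 r)"
    and C1_Er: "C1_on {(x0, r). r > 0} (\<lambda>(x0, r). Er x0 r)"
    and div_eq: "\<And>x0 r. r > 0 \<Longrightarrow>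
      r * (d_x0 E0 x0 r + d_rho Er x0 r) - (\<alpha> - 1) * Er x0 r = 0"
    and curl_eq: "\<And>x0 r. r > 0 \<Longrightarrow> d_rho E0 x0 r = d_x0 Er x0 r"
    and off_axis: "rho x > 0"
  shows "let J = gradient_tensor (meridional_field E0 Er) x;
             q = Er (x $ 0) (rho x) / rho x;
             a = d_x0 Er (x $ 0) (rho x);
             b = d_rho Er (x $ 0) (rho x);
             D = (\<alpha> - 1)\<^sup>2 / 4 * q\<^sup>2 - (\<alpha> - 1) * q * b + a\<^sup>2 + b\<^sup>2;
             l0 = q;
             l1 = (\<alpha> - 1) / 2 * q + sqrt D;
             l2 = (\<alpha> - 1) / 2 * q - sqrt D
         in proots (charpoly J) = {#l0, l1, l2#} \<and>
            l1 * l2 = (\<alpha> - 1) * q * b - a\<^sup>2 - b\<^sup>2"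
proof -
  define J where "J = gradient_tensor (meridional_field E0 Er) x"
  define q where "q = Er (x $ 0) (rho x) / rho x"
  define a where "a = d_x0 Er (x $ 0) (rho x)"
  define b where "b = d_rho Er (x $ 0) (rho x)"
  define p where "p = d_x0 E0 (x $ 0) (rho x)"
  define D where "D = (\<alpha> - 1)\<^sup>2 / 4 * q\<^sup>2 - (\<alpha> - 1) * q * b + a\<^sup>2 + b\<^sup>2"
  define l1 where "l1 = (\<alpha> - 1) / 2 * q + sqrt D"
  define l2 where "l2 = (\<alpha> - 1) / 2 * q - sqrt D"
  \<comment> \<open>The divergence equation divided by \<open>rho x\<close>.\<close>
  have p: "p = (\<alpha> - 1) * q - b"
    using div_eq[OF off_axis, of "x $ 0"] off_axis by (simp add: p_def q_def b_def field_simps)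
  \<comment> \<open>A sum of squares is nonnegative, which is what makes \<open>sqrt D\<close>
    square back to \<open>D\<close>.\<close>
  have "D = ((\<alpha> - 1) / 2 * q - b)\<^sup>2 + a\<^sup>2"
    by (simp add: D_def power2_eq_square field_simps)
  then have "(sqrt D)\<^sup>2 = D" by simp
  moreover have "l1 * l2 = ((\<alpha> - 1) / 2 * q)\<^sup>2 - (sqrt D)\<^sup>2"
    by (simp add: l1_def l2_def power2_eq_square algebra_simps)
  ultimately have prod: "l1 * l2 = (\<alpha> - 1) * q * b - a\<^sup>2 - b\<^sup>2"
    by (simp add: D_def power_mult_distrib power_divide)
  \<comment> \<open>Off the axis (x_1, x_2) / rho is a unit vector, as
    \<open>charpoly_meridional\<close> requires.\<close>
  have "(rho x)\<^sup>2 = (x $ 1)\<^sup>2 + (x $ 2)\<^sup>2"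
    by (simp add: rho_def)
  moreover have "(rho x)\<^sup>2 \<noteq> 0"
    using off_axis by simp
  ultimately have "(x $ 1 / rho x)\<^sup>2 + (x $ 2 / rho x)\<^sup>2 = 1"
    unfolding power_divide add_divide_distrib[symmetric] by (metis divide_self)
  \<comment> \<open>Rewriting with \<open>curl_eq\<close> turns the first row's
    \<open>d_rho E0\<close> into \<open>d_x0 Er\<close>, making the tensor symmetric.\<close>
  then have "charpoly J = [:- q, 1:] * [:p * b - a\<^sup>2, - (p + b), 1:]"
    unfolding J_def gradient_tensor_meridional_field[OF C1_E0 C1_Er off_axis] curl_eq[OF off_axis]
      a_def b_def p_def q_def
    by (rule charpoly_meridional)
  \<comment> \<open>Vieta: the determinant and trace of the block are the product and sum of
    \<open>l1\<close> and \<open>l2\<close>.\<close>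
  also have "[:p * b - a\<^sup>2, - (p + b), 1:] = [:- l1, 1:] * [:- l2, 1:]"
  proof -
    have "p * b - a\<^sup>2 = l1 * l2"
      unfolding prod p by (simp add: power2_eq_square algebra_simps)
    moreover have "p + b = l1 + l2"
      by (simp add: p l1_def l2_def)
    ultimately show ?thesis by (simp add: algebra_simps)
  qed
  \<comment> \<open>The deleted simp rules would multiply the factors out; kept as a product of
    linear factors, the polynomial yields its roots with multiplicity, also when they
    coincide.\<close>
  finally have "proots (charpoly J) = {#q, l1, l2#}"
    by (simp add: proots_mult del: mult_pCons_left mult_pCons_right)
  with prod show ?thesis
    unfolding Let_def J_def q_def a_def b_def D_def l1_def l2_def by simp
qed

end
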